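(* In the formal power series ring $\mathbb{Q}[[x]]$, let $\beta=\sum_{k=0}^{\infty}C_kx^{k+1}=\frac{1-\sqrt{1-4x}}{2}$, where $C_k=\frac{1}{k+1}\binom{2k}{k}$, so that $\beta(1-\beta)=x$. Then \[ \sum_{k=1}^{\infty}\binom{2k}{k}H_k^{(2)}x^k=\frac{2{\rm Li}_2(\beta)+{\rm Li}_1(\beta)^2}{1-2\beta}, \] and \[ \sum_{k=1}^{\infty}C_kH_k^{(2)}x^{k+1}=2\beta\,{\rm Li}_2(\beta)-(1-\beta){\rm Li}_1(\beta)^2. \]
   Context: $H_k^{(d)}=\sum_{j=1}^{k}1/j^d$ denotes the generalized harmonic number. For an integer $d$, ${\rm Li}_d(t)=\sum_{k=1}^{\infty}t^k/k^d$ is the polylogarithm viewed as a formal power series; ${\rm Li}_d(\beta)$ denotes its composition with $\beta\in x\mathbb{Q}[[x]]$. *)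

theory Defs
  imports "HOL-Computational_Algebra.Computational_Algebra"
begin

unbundle fps_syntax

definition gen_harm :: "int \<Rightarrow> nat \<Rightarrow> rat" where
  "gen_harm d k = (\<Sum>j=1..k. 1 / of_nat j powi d)"

text \<open>The series starts at k = 1, so the constant coefficient is set to 0 explicitly
  (the formula would give 1 at k = 0 for d = 0).\<close>

definition Li :: "int \<Rightarrow> rat fps" where
  "Li d = Abs_fps (\<lambda>k. if k = 0 then 0 else 1 / of_nat k powi d)"

definition catalan :: "nat \<Rightarrow> rat" where
  "catalan k = 1 / of_nat (k + 1) * of_nat ((2 * k) choose k)"

definition beta :: "rat fps" where
  "beta = fps_X * Abs_fps catalan"

text \<open>The function given to \<^const>\<open>fps_radical\<close> only selects the constant coefficient of the root.
  The constant function 1 therefore selects the square root with constant coefficient 1;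
  the argument must itself have constant coefficient 1.\<close>

definition fps_sqrt1 :: "rat fps \<Rightarrow> rat fps" where
  "fps_sqrt1 f = fps_radical (\<lambda>_ _. 1) 2 f"

end

(* Differentiating beta * (1 - beta) = X gives (1 - 2 beta) beta' = 1. With L_d the composition of
   Li d with beta, the chain rule gives beta L_2' = beta' L_1 and (1 - beta) L_1' = beta'.
   The recurrence for the central binomial coefficients is a first-order linear differential
   equation for the harmonic generating function F, with integrating factor 1 - 2 beta and
   right-hand side proportional to L_1; both sides of the first identity, multiplied by that
   factor, have derivative 2 L_1 beta' / X. Both sides of the second one have derivative F. *)
theory Submission
  imports Defs
begin

section \<open>Coefficient recurrences and derivatives of the polylogarithms\<close>

lemma central_binomial_Suc:
  "of_nat (n + 1) * (of_nat ((2 * Suc n) choose Suc n) :: 'a :: field_char_0)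
    = 2 * of_nat (2 * n + 1) * of_nat ((2 * n) choose n)"
proof -
  have "Suc n * ((2 * Suc n) choose Suc n) = (2 * Suc n) * ((2 * n + 1) choose n)"
    using Suc_times_binomial_eq[of "2 * n + 1" n] by (simp add: mult.commute)
  moreover have "Suc n * ((2 * n + 1) choose n) = (2 * n + 1) * ((2 * n) choose n)"
    using Suc_times_binomial_eq[of "2 * n" n] binomial_symmetric[of n "2 * n + 1"]
    by (simp add: mult.commute)
  ultimately have "Suc n * (Suc n * ((2 * Suc n) choose Suc n))
      = Suc n * (2 * (2 * n + 1) * ((2 * n) choose n))"
    by (metis mult.assoc mult.commute)
  then have "Suc n * ((2 * Suc n) choose Suc n) = 2 * (2 * n + 1) * ((2 * n) choose n)"
    by (simp only: mult_cancel1) simp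
  then have "(of_nat (Suc n * ((2 * Suc n) choose Suc n)) :: 'a)
      = of_nat (2 * (2 * n + 1) * ((2 * n) choose n))"
    by (simp only:)
  then show ?thesis
    by (simp only: of_nat_mult of_nat_numeral Suc_eq_plus1)
qed

lemma gen_harm_0 [simp]: "gen_harm d 0 = 0"
  by (simp add: gen_harm_def)

lemma gen_harm_Suc: "gen_harm d (Suc n) = gen_harm d n + 1 / of_nat (Suc n) powi d"
  by (simp add: gen_harm_def)

lemma fps_X_mult_deriv_Li: "fps_X * fps_deriv (Li d) = Li (d - 1)"
proof (rule fps_ext)
  fix n
  have "of_nat n / of_nat n powi d = 1 / (of_nat n :: rat) powi (d - 1)" if "n > 0"
    using that by (simp add: power_int_diff)
  then show "(fps_X * fps_deriv (Li d)) $ n = Li (d - 1) $ n"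
    by (cases n) (simp_all add: Li_def)
qed

text \<open>Differentiation cancels every denominator and leaves the geometric series.\<close>

lemma deriv_Li_1: "(1 - fps_X) * fps_deriv (Li 1) = 1"
proof (rule fps_ext)
  fix n show "((1 - fps_X) * fps_deriv (Li 1)) $ n = 1 $ n"
    by (cases n) (simp_all add: Li_def left_diff_distrib del: of_nat_Suc)
qed

text \<open>The quotient \<open>w\<close> of \<open>f\<close> by \<open>g\<close> satisfies
  \<open>g * g * w' = g * f' - g' * f = 0\<close>, so it is constant, and its constant coefficient
  is 1.\<close>

lemma fps_deriv_proportional_imp_eq:
  fixes f g :: "'a :: field_char_0 fps"
  assumes deriv: "g * fps_deriv f = fps_deriv g * f" and "f $ 0 = g $ 0" and "g $ 0 \<noteq> 0"
  shows "f = g"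
proof -
  define w where "w = f * inverse g"
  have f: "f = w * g"
    using \<open>g $ 0 \<noteq> 0\<close> by (simp add: w_def mult.assoc inverse_mult_eq_1)
  have "g * g * fps_deriv w = 0"
    using deriv by (simp add: f algebra_simps)
  moreover have "g \<noteq> 0"
    using \<open>g $ 0 \<noteq> 0\<close> by auto
  ultimately have "fps_deriv w = 0"
    by simp
  then have "w = fps_const (w $ 0)"
    by (simp add: fps_deriv_eq_0_iff)
  moreover have "w $ 0 = 1"
    using assms(2,3) by (simp add: w_def)
  ultimately show ?thesis
    using f by simp
qed

section \<open>The Catalan series: closed form and quadratic equation\<close>

lemma catalan_0 [simp]: "catalan 0 = 1"
  by (simp add: catalan_def)

lemma Suc_mult_catalan: "of_nat (Suc n) * catalan n = of_nat ((2 * n) choose n)"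
  by (simp add: catalan_def del: of_nat_Suc)

lemma beta_nth_0 [simp]: "beta $ 0 = 0"
  by (simp add: beta_def)

lemma deriv_beta_nth: "fps_deriv beta $ n = of_nat ((2 * n) choose n)"
  by (simp add: beta_def ring_distribs add.commute flip: Suc_mult_catalan)

lemma deriv_beta_ode: "(1 - 4 * fps_X) * fps_deriv beta = 1 - 2 * beta"
proof (rule fps_ext)
  fix n
  show "((1 - 4 * fps_X) * fps_deriv beta) $ n = (1 - 2 * beta) $ n"
  proof (cases n)
    case 0
    then show ?thesis
      using deriv_beta_nth[of 0] by (simp add: left_diff_distrib mult.assoc numeral_fps_const)
  next
    case (Suc m)
    define c where "c = (of_nat ((2 * m) choose m) :: rat)"
    have m: "of_nat m + 1 \<noteq> (0 :: rat)"
      using of_nat_neq_0[of m, where ?'a = rat] by (simp add: add.commute)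
    \<comment> \<open>By the recurrence the left side is
      \<open>(2 * (2 * m + 1) - 4 * (m + 1)) * c\<close>.\<close>
    have "(of_nat m + 1) * (of_nat ((2 * Suc m) choose Suc m) - 4 * c) = - 2 * c"
      using central_binomial_Suc[of m, where ?'a = rat]
      by (simp add: c_def algebra_simps del: binomial_Suc_Suc mult_Suc_right)
    then have "of_nat ((2 * Suc m) choose Suc m) - 4 * c = - 2 * c / (of_nat m + 1)"
      using m by (simp only: nonzero_eq_divide_eq mult.commute simp_thms)
    moreover have "beta $ Suc m = c / (of_nat m + 1)"
      by (simp add: beta_def catalan_def c_def add.commute)
    ultimately show ?thesis
      using deriv_beta_nth[of m] deriv_beta_nth[of "Suc m"]
      by (simp add: Suc left_diff_distrib mult.assoc numeral_fps_const c_def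
          del: fps_deriv_nth of_nat_Suc binomial_Suc_Suc)
  qed
qed

text \<open>Both sides solve \<open>(1 - 4 * fps_X) * y' = - 4 * y\<close> with constant coefficient
  1. This replaces the usual convolution argument for the Catalan numbers.\<close>

lemma sqrt_beta_power2: "(1 - 2 * beta)\<^sup>2 = 1 - 4 * fps_X"
proof (rule fps_deriv_proportional_imp_eq)
  have "(1 - 4 * fps_X) * fps_deriv ((1 - 2 * beta)\<^sup>2)
      = - 4 * (1 - 2 * beta) * ((1 - 4 * fps_X) * fps_deriv beta)"
    by (simp add: power2_eq_square algebra_simps)
  also have "\<dots> = fps_deriv (1 - 4 * fps_X) * (1 - 2 * beta)\<^sup>2"
    unfolding deriv_beta_ode by (simp add: power2_eq_square algebra_simps)
  finally show "(1 - 4 * fps_X) * fps_deriv ((1 - 2 * beta)\<^sup>2)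
      = fps_deriv (1 - 4 * fps_X) * (1 - 2 * beta)\<^sup>2" .
qed (simp_all add: power2_eq_square)

lemma beta_eq_sqrt: "beta = (1 - fps_sqrt1 (1 - 4 * fps_X)) / 2"
proof -
  have "fps_sqrt1 (1 - 4 * fps_X) = 1 - 2 * beta"
    unfolding fps_sqrt1_def
    \<comment> \<open>The exponent in \<open>radical_unique\<close> is a successor, so the argument
      1 stands for a square root. The selected constant coefficient 1 is that of
      \<open>1 - 2 * beta\<close>.\<close>
    using radical_unique[of "\<lambda>_ _. 1" 1 "1 - 4 * fps_X :: rat fps" "1 - 2 * beta"]
      sqrt_beta_power2 by (simp add: numeral_2_eq_2)
  then show ?thesis
    by simp
qed

lemma beta_quadratic: "beta * (1 - beta) = fps_X"
proof -
  have "4 * (beta * (1 - beta)) = 4 * fps_X"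
    using sqrt_beta_power2 by (simp add: power2_eq_square algebra_simps)
  then show ?thesis
    by simp
qed

lemma deriv_beta: "(1 - 2 * beta) * fps_deriv beta = 1"
proof -
  have "fps_deriv (beta * (1 - beta)) = 1"
    by (simp add: beta_quadratic)
  then show ?thesis
    by (simp add: algebra_simps)
qed

section \<open>Polylogarithms composed with the Catalan series\<close>

lemma deriv_Li_beta:
  "beta * fps_deriv (Li d oo beta) = fps_deriv beta * (Li (d - 1) oo beta)"
proof -
  \<comment> \<open>Composition turns \<open>fps_X\<close> into \<open>beta\<close>. The factor
    stays on the left because \<open>beta\<close> has constant coefficient 0 and hence no
    inverse.\<close>
  have "beta * (fps_deriv (Li d) oo beta) = Li (d - 1) oo beta"
    by (simp add: fps_compose_mult_distrib flip: fps_X_mult_deriv_Li)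
  then show ?thesis
    by (simp add: fps_compose_deriv flip: mult.assoc)
qed

lemma deriv_Li_1_beta: "(1 - beta) * fps_deriv (Li 1 oo beta) = fps_deriv beta"
proof -
  have "((1 - fps_X) * fps_deriv (Li 1)) oo beta = 1"
    by (simp add: deriv_Li_1)
  then have "(1 - beta) * (fps_deriv (Li 1) oo beta) = 1"
    by (simp add: fps_compose_mult_distrib fps_compose_sub_distrib)
  then show ?thesis
    by (simp add: fps_compose_deriv flip: mult.assoc)
qed

text \<open>Writing \<open>fps_X\<close> as \<open>beta * (1 - beta)\<close> reduces the Euler
  derivative of the series to \<open>2 * beta * beta'\<close>, which is \<open>beta' - 1\<close>;
  the coefficients of \<open>beta'\<close> are the central binomials.\<close>

lemma Li_1_beta_nth: "(2 * (Li 1 oo beta)) $ n = of_nat ((2 * n) choose n) / of_nat n" if "n > 0"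
proof -
  have "fps_X * fps_deriv (2 * (Li 1 oo beta))
      = 2 * beta * ((1 - beta) * fps_deriv (Li 1 oo beta))"
    by (simp add: algebra_simps flip: beta_quadratic)
  also have "\<dots> = fps_deriv beta - 1"
    unfolding deriv_Li_1_beta using deriv_beta by (simp add: algebra_simps)
  finally have "(fps_X * fps_deriv (2 * (Li 1 oo beta))) $ n = (fps_deriv beta - 1) $ n"
    by simp
  moreover have "(fps_X * fps_deriv f) $ n = of_nat n * f $ n" for f :: "rat fps"
    using that by (cases n) simp_all
  ultimately have "of_nat n * (2 * (Li 1 oo beta)) $ n = (fps_deriv beta - 1) $ n"
    by metis
  also have "\<dots> = of_nat ((2 * n) choose n)"
    using that deriv_beta_nth[of n] by simp
  finally have "of_nat n * (2 * (Li 1 oo beta)) $ n = of_nat ((2 * n) choose n)" .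
  then show ?thesis
    using that by (simp add: field_simps)
qed

section \<open>The harmonic generating functions\<close>

definition central_harmonic_fps :: "rat fps" where
  "central_harmonic_fps = Abs_fps (\<lambda>k. of_nat ((2 * k) choose k) * gen_harm 2 k)"

lemma central_harmonic_ode:
  "fps_X * ((1 - 4 * fps_X) * fps_deriv central_harmonic_fps - 2 * central_harmonic_fps)
    = 2 * (Li 1 oo beta)"
  (is "?lhs = _")
proof (rule fps_ext)
  fix n
  show "?lhs $ n = (2 * (Li 1 oo beta)) $ n"
  proof (cases n)
    case 0
    then show ?thesis
      by (simp add: Li_def)
  next
    case (Suc m)
    let ?F = central_harmonic_fps
    define c where "c = (of_nat ((2 * m) choose m) :: rat)"
    define d where "d = (of_nat ((2 * Suc m) choose Suc m) :: rat)"
    have d: "of_nat (Suc m) * d = 2 * of_nat (2 * m + 1) * c"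
      using central_binomial_Suc[of m, where ?'a = rat]
      unfolding c_def d_def by (simp only: Suc_eq_plus1)
    have "?lhs $ n = of_nat (Suc m) * ?F $ Suc m - 4 * of_nat m * ?F $ m - 2 * ?F $ m"
      by (cases m) (simp_all add: Suc left_diff_distrib mult.assoc numeral_fps_const)
    also have "\<dots> = of_nat (Suc m) * d * gen_harm 2 (Suc m)
        - 2 * of_nat (2 * m + 1) * c * gen_harm 2 m"
      by (simp add: central_harmonic_fps_def c_def d_def algebra_simps
          del: binomial_Suc_Suc mult_Suc_right)
    \<comment> \<open>The recurrence \<open>d\<close> gives both harmonic numbers the same factor,
      so only their difference survives.\<close>
    also have "\<dots> = of_nat (Suc m) * d * (1 / of_nat (Suc m) ^ 2)"
      unfolding d[symmetric] gen_harm_Suc by (simp add: algebra_simps del: of_nat_Suc)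
    also have "\<dots> = d / of_nat (Suc m)"
      by (simp add: power2_eq_square del: of_nat_Suc)
    also have "\<dots> = (2 * (Li 1 oo beta)) $ n"
      using Li_1_beta_nth[of "Suc m"] by (simp add: Suc d_def)
    finally show ?thesis .
  qed
qed

text \<open>With \<open>fps_X = beta * (1 - beta)\<close>, the two derivatives contribute
  \<open>L1 * b'\<close> with weights \<open>2 * (1 - beta)\<close> and \<open>2 * beta\<close>. The
  square is what makes these weights add up to the constant 2.\<close>

lemma deriv_Li_combination:
  "fps_X * fps_deriv (2 * (Li 2 oo beta) + (Li 1 oo beta)\<^sup>2)
    = 2 * fps_deriv beta * (Li 1 oo beta)"
proof -
  define L1 L2 b' where "L1 = Li 1 oo beta" and "L2 = Li 2 oo beta" and "b' = fps_deriv beta"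
  have "fps_X * fps_deriv (2 * L2 + L1\<^sup>2)
      = 2 * (1 - beta) * (beta * fps_deriv L2) + 2 * L1 * beta * ((1 - beta) * fps_deriv L1)"
    by (simp add: power2_eq_square algebra_simps flip: beta_quadratic)
  also have "\<dots> = 2 * (1 - beta) * (b' * L1) + 2 * L1 * beta * b'"
    using deriv_Li_beta[of 2] deriv_Li_1_beta by (simp add: L1_def L2_def b'_def)
  also have "\<dots> = 2 * b' * L1"
    by (simp add: algebra_simps)
  finally show ?thesis
    by (simp add: L1_def L2_def b'_def)
qed

lemma central_harmonic_eq:
  "central_harmonic_fps * (1 - 2 * beta) = 2 * (Li 2 oo beta) + (Li 1 oo beta)\<^sup>2"
proof -
  define F s b' where "F = central_harmonic_fps" and "s = 1 - 2 * beta" and "b' = fps_deriv beta"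
  have sb: "s * b' = 1"
    using deriv_beta by (simp add: s_def b'_def)
  have s2: "s * s = 1 - 4 * fps_X"
    using sqrt_beta_power2 by (simp add: s_def power2_eq_square)
  have ds: "fps_deriv s = - 2 * b'"
    by (simp add: s_def b'_def)
  have ode: "fps_X * ((s * s) * fps_deriv F - 2 * F) = 2 * (Li 1 oo beta)"
    using central_harmonic_ode by (simp only: s2 F_def)
  \<comment> \<open>Inserting \<open>s * b' = 1\<close> supplies the second factor \<open>s\<close>
    that the differential equation in \<open>s * s\<close> needs, without any division.\<close>
  have "fps_X * fps_deriv (F * s) = (s * b') * (fps_X * fps_deriv (F * s))"
    by (simp add: sb)
  also have "\<dots> = b' * (fps_X * ((s * s) * fps_deriv F - 2 * (s * b') * F))"
    by (simp add: ds algebra_simps)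
  also have "\<dots> = 2 * b' * (Li 1 oo beta)"
    by (simp only: sb mult_1_right ode) simp
  also have "\<dots> = fps_X * fps_deriv (2 * (Li 2 oo beta) + (Li 1 oo beta)\<^sup>2)"
    by (simp only: deriv_Li_combination b'_def)
  finally have "fps_deriv (F * s) = fps_deriv (2 * (Li 2 oo beta) + (Li 1 oo beta)\<^sup>2)"
    by (simp only: mult_cancel_left) simp
  then have "F * s = fps_const ((F * s) $ 0 - (2 * (Li 2 oo beta) + (Li 1 oo beta)\<^sup>2) $ 0)
      + (2 * (Li 2 oo beta) + (Li 1 oo beta)\<^sup>2)"
    by (simp only: fps_deriv_eq_iff)
  moreover have "(F * s) $ 0 = 0" "(2 * (Li 2 oo beta) + (Li 1 oo beta)\<^sup>2) $ 0 = 0"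
    by (simp_all add: F_def central_harmonic_fps_def Li_def power2_eq_square)
  ultimately show ?thesis
    by (simp add: F_def s_def)
qed

lemma catalan_harmonic_eq:
  "fps_X * Abs_fps (\<lambda>k. catalan k * gen_harm 2 k)
    = 2 * beta * (Li 2 oo beta) - (1 - beta) * (Li 1 oo beta)\<^sup>2"
  (is "?P = ?R")
proof -
  define L1 L2 b' where "L1 = Li 1 oo beta" and "L2 = Li 2 oo beta" and "b' = fps_deriv beta"
  \<comment> \<open>Differentiating \<open>x^(k+1)\<close> brings down \<open>k + 1\<close>, which
    turns \<open>catalan k\<close> into the central binomial.\<close>
  have "fps_deriv ?P = central_harmonic_fps"
    by (rule fps_ext) (simp add: central_harmonic_fps_def ring_distribs mult.assoc add.commute
        flip: Suc_mult_catalan)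
  also have "\<dots> = central_harmonic_fps * (1 - 2 * beta) * b'"
    using deriv_beta by (simp add: mult.assoc b'_def)
  also have "\<dots> = b' * (2 * L2 + L1\<^sup>2)"
    by (simp add: central_harmonic_eq L1_def L2_def)
  \<comment> \<open>The term \<open>2 * b' * L1\<close> is added and subtracted: one copy becomes
    \<open>2 * beta * L2'\<close>, the other \<open>2 * L1 * (1 - beta) * L1'\<close>, as the
    product rule for the right-hand side requires.\<close>
  also have "\<dots> = 2 * b' * L2 + 2 * (b' * L1) + b' * L1\<^sup>2 - 2 * L1 * b'"
    by (simp add: algebra_simps)
  also have "\<dots> = 2 * b' * L2 + 2 * (beta * fps_deriv L2) + b' * L1\<^sup>2
      - 2 * L1 * ((1 - beta) * fps_deriv L1)"
    using deriv_Li_beta[of 2] deriv_Li_1_beta by (simp add: L1_def L2_def b'_def)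
  also have "\<dots> = fps_deriv ?R"
    by (simp add: power2_eq_square algebra_simps flip: L1_def L2_def b'_def)
  finally have "?P = fps_const (?P $ 0 - ?R $ 0) + ?R"
    by (simp only: fps_deriv_eq_iff)
  moreover have "?P $ 0 = 0" "?R $ 0 = 0"
    by (simp_all add: Li_def power2_eq_square)
  ultimately show ?thesis
    by simp
qed

theorem theorem5p1:
  shows "beta = (1 - fps_sqrt1 (1 - 4 * fps_X)) / 2 \<and>
    beta * (1 - beta) = fps_X \<and>
    Abs_fps (\<lambda>k. if k = 0 then 0 else of_nat ((2 * k) choose k) * gen_harm 2 k)
      = (2 * (Li 2 oo beta) + (Li 1 oo beta)\<^sup>2) / (1 - 2 * beta) \<and>
    fps_X * Abs_fps (\<lambda>k. if k = 0 then 0 else catalan k * gen_harm 2 k)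
      = 2 * beta * (Li 2 oo beta) - (1 - beta) * (Li 1 oo beta)\<^sup>2"
proof (intro conjI)
  have "1 - 2 * beta \<noteq> 0"
    using deriv_beta by auto
  \<comment> \<open>The case \<open>k = 0\<close> changes nothing, as \<open>gen_harm 2 0\<close> is
    an empty sum.\<close>
  moreover have "Abs_fps (\<lambda>k. if k = 0 then 0 else of_nat ((2 * k) choose k) * gen_harm 2 k)
      = central_harmonic_fps"
    by (rule fps_ext) (simp add: central_harmonic_fps_def)
  ultimately show
    "Abs_fps (\<lambda>k. if k = 0 then 0 else of_nat ((2 * k) choose k) * gen_harm 2 k)
      = (2 * (Li 2 oo beta) + (Li 1 oo beta)\<^sup>2) / (1 - 2 * beta)"
    by (simp flip: central_harmonic_eq)
  have "(\<lambda>k. if k = 0 then 0 else catalan k * gen_harm 2 k) = (\<lambda>k. catalan k * gen_harm 2 k)"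
    by auto
  then show "fps_X * Abs_fps (\<lambda>k. if k = 0 then 0 else catalan k * gen_harm 2 k)
      = 2 * beta * (Li 2 oo beta) - (1 - beta) * (Li 1 oo beta)\<^sup>2"
    by (simp only: catalan_harmonic_eq)
qed (fact beta_eq_sqrt beta_quadratic)+

end
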